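(* Let $d\in\mathbb N$, $a\in\mathbb N_0$. The generalized unsigned scaled Stirling numbers of the first kind satisfy $\widehat{S1p}(d,a;0,0)=1$ and, for all $n\ge1$ and $m=0,1,\dots,n$, $$\widehat{S1p}(d,a;n,m)=\widehat{S1p}(d,a;n-1,m-1)+\big(d\,n-(d-a)\big)\,\widehat{S1p}(d,a;n-1,m).$$
   Context: $\mathbb N=\{1,2,\dots\}$, $\mathbb N_0=\{0,1,2,\dots\}$. The generalized Stirling numbers of the second kind $S2(d,a;n,m)$, $0\le m\le n$, are defined by the operator identity $(a\,\mathbf 1+d\,\mathbf E_x)^n=\sum_{m=0}^n S2(d,a;n,m)\,x^m\,\mathbf d_x^{\,m}$, where $\mathbf d_x$ is differentiation with respect to $x$, $\mathbf E_x:=x\,\mathbf d_x$ and $\mathbf 1$ is the identity operator; $S2(d,a;n,m):=0$ for $m>n$. Let $\mathbf{S1}[d,a]=(S1(d,a;n,m))_{n,m\ge0}$ be the inverse of the infinite lower triangular matrix $\mathbf{S2}[d,a]=(S2(d,a;n,m))_{n,m\ge0}$, and set $\widehat{S1p}(d,a;n,m):=d^n\,(-1)^{n-m}\,S1(d,a;n,m)$. By convention $\widehat{S1p}(d,a;n,-1)=0$, and $\widehat{S1p}(d,a;n,m)=0$ for $n<m$. *)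

theory Defs
  imports "HOL-Computational_Algebra.Polynomial"
begin

text \<open>
  The operators \<open>\<^bold>d\<^sub>x\<close> (which is \<^const>\<open>pderiv\<close>) and \<open>\<^bold>E\<^sub>x = x \<^bold>d\<^sub>x\<close> act on the rational
  polynomials \<open>\<rat>[x]\<close>. This action is faithful, so an identity between polynomial differential
  operators holds on \<open>\<rat>[x]\<close> iff it holds as a formal identity.
\<close>

definition Euler_op :: "rat poly \<Rightarrow> rat poly" where
  "Euler_op p = monom 1 1 * pderiv p"

definition Stirling_op :: "nat \<Rightarrow> nat \<Rightarrow> rat poly \<Rightarrow> rat poly" where
  "Stirling_op d a p = smult (of_nat a) p + smult (of_nat d) (Euler_op p)"

text \<open>
  The operators \<open>x\<^sup>m \<^bold>d\<^sub>x\<^sup>m\<close> are linearly independent, so the coefficients are uniquely determined.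
\<close>

definition S2 :: "nat \<Rightarrow> nat \<Rightarrow> nat \<Rightarrow> nat \<Rightarrow> rat" where
  "S2 d a = (THE S.
     (\<forall>n. (Stirling_op d a ^^ n) =
       (\<lambda>p. \<Sum>m\<le>n. smult (S n m) (monom 1 m * (pderiv ^^ m) p))) \<and>
     (\<forall>n m. n < m \<longrightarrow> S n m = 0))"

definition lower_triangular :: "(nat \<Rightarrow> nat \<Rightarrow> 'a::zero) \<Rightarrow> bool" where
  "lower_triangular A \<longleftrightarrow> (\<forall>n m. n < m \<longrightarrow> A n m = 0)"

text \<open>
  The product of infinite matrices, for a lower triangular left factor: the entries
  \<open>A n k\<close> with \<open>k > n\<close> vanish, so that the sum over all \<open>k\<close> stops at \<open>n\<close>.
\<close>

definition lt_mult ::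
    "(nat \<Rightarrow> nat \<Rightarrow> 'a::comm_ring_1) \<Rightarrow> (nat \<Rightarrow> nat \<Rightarrow> 'a) \<Rightarrow> nat \<Rightarrow> nat \<Rightarrow> 'a" where
  "lt_mult A B = (\<lambda>n m. \<Sum>k\<le>n. A n k * B k m)"

definition id_matrix :: "nat \<Rightarrow> nat \<Rightarrow> 'a::comm_ring_1" where
  "id_matrix = (\<lambda>n m. if n = m then 1 else 0)"

definition lt_inverse :: "(nat \<Rightarrow> nat \<Rightarrow> 'a::comm_ring_1) \<Rightarrow> nat \<Rightarrow> nat \<Rightarrow> 'a" where
  "lt_inverse A =
    (THE B. lower_triangular B \<and> lt_mult A B = id_matrix \<and> lt_mult B A = id_matrix)"

definition S1 :: "nat \<Rightarrow> nat \<Rightarrow> nat \<Rightarrow> nat \<Rightarrow> rat" where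
  "S1 d a = lt_inverse (S2 d a)"

text \<open>
  The column index is an integer because of the convention for column \<open>-1\<close>.
\<close>

definition S1p_hat :: "nat \<Rightarrow> nat \<Rightarrow> nat \<Rightarrow> int \<Rightarrow> rat" where
  "S1p_hat d a n m =
    (if 0 \<le> m \<and> m \<le> int n
     then of_nat d ^ n * (- 1) ^ (n - nat m) * S1 d a n (nat m)
     else 0)"

end

theory Submission
  imports Defs
begin

text \<open>
  Since \<open>(a + d E) x\<^sup>m D\<^sup>m = (a + d m) x\<^sup>m D\<^sup>m + d x\<^sup>m\<^sup>+\<^sup>1 D\<^sup>m\<^sup>+\<^sup>1\<close>, the numbers \<open>S2\<close> satisfy
  \<open>S2(n+1,m) = (a + d m) S2(n,m) + d S2(n,m-1)\<close>. The array \<open>B\<close> given by \<open>B(0,m) = \<delta>(0,m)\<close> and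
  \<open>d B(n+1,m) = B(n,m-1) - (d n + a) B(n,m)\<close> is a two-sided inverse: the two recurrences turn
  \<open>P = S2 B\<close> into \<open>P(n+1,m) = P(n,m-1)\<close> and \<open>Q = B S2\<close> into
  \<open>Q(n+1,m) = (m - n) Q(n,m) + Q(n,m-1)\<close>, and both are solved by the identity matrix only.
  The recurrence of \<open>B\<close> is the claim, up to scaling and signs.
\<close>

fun S2_rec :: "nat \<Rightarrow> nat \<Rightarrow> nat \<Rightarrow> nat \<Rightarrow> rat" where
  "S2_rec d a 0 m = (if m = 0 then 1 else 0)"
| "S2_rec d a (Suc n) 0 = of_nat a * S2_rec d a n 0"
| "S2_rec d a (Suc n) (Suc m) =
     (of_nat a + of_nat d * of_nat (Suc m)) * S2_rec d a n (Suc m) + of_nat d * S2_rec d a n m"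

text \<open>The array \<open>B\<close> above, its recurrence solved for the next row by dividing by
  \<open>d\<close>.\<close>

fun S1_rec :: "nat \<Rightarrow> nat \<Rightarrow> nat \<Rightarrow> nat \<Rightarrow> rat" where
  "S1_rec d a 0 m = (if m = 0 then 1 else 0)"
| "S1_rec d a (Suc n) 0 = - (of_nat n + of_nat a / of_nat d) * S1_rec d a n 0"
| "S1_rec d a (Suc n) (Suc m) =
     - (of_nat n + of_nat a / of_nat d) * S1_rec d a n (Suc m) + inverse (of_nat d) * S1_rec d a n m"

lemma S2_rec_eq_0: "n < m \<Longrightarrow> S2_rec d a n m = 0"
  by (induction d a n m rule: S2_rec.induct) auto

lemma S1_rec_eq_0: "n < m \<Longrightarrow> S1_rec d a n m = 0"
  by (induction d a n m rule: S1_rec.induct) auto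

text \<open>Shifting the index of the \<open>c * u k\<close> part moves a row recurrence from
  \<open>v\<close> onto \<open>g\<close>; the boundary term at \<open>Suc n\<close> vanishes with
  \<open>u (Suc n)\<close>. Both matrix products and the operator powers are computed this
  way.\<close>

lemma sum_row_recurrence:
  fixes u v w g :: "nat \<Rightarrow> 'a::comm_ring_1"
  assumes "v 0 = w 0 * u 0"
    and "\<And>k. v (Suc k) = w (Suc k) * u (Suc k) + c * u k"
    and "u (Suc n) = 0"
  shows "(\<Sum>k\<le>Suc n. v k * g k) = (\<Sum>k\<le>n. u k * (w k * g k + c * g (Suc k)))"
proof -
  have "(\<Sum>k\<le>Suc n. v k * g k) = v 0 * g 0 + (\<Sum>k\<le>n. v (Suc k) * g (Suc k))"
    by (rule sum.atMost_Suc_shift)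
  also have "\<dots> = (w 0 * u 0 * g 0 + (\<Sum>k\<le>n. w (Suc k) * u (Suc k) * g (Suc k)))
      + (\<Sum>k\<le>n. c * u k * g (Suc k))"
    by (simp add: assms algebra_simps sum.distrib)
  also have "w 0 * u 0 * g 0 + (\<Sum>k\<le>n. w (Suc k) * u (Suc k) * g (Suc k))
      = (\<Sum>k\<le>Suc n. w k * u k * g k)"
    by (rule sum.atMost_Suc_shift [symmetric])
  also have "\<dots> = (\<Sum>k\<le>n. w k * u k * g k)"
    by (simp add: assms)
  finally show ?thesis
    by (simp add: sum.distrib algebra_simps)
qed

section \<open>Normal ordering of the powers of a + d E\<close>

lemma Stirling_op_sum_smult:
  "Stirling_op d a (\<Sum>i\<in>A. smult (c i) (f i)) = (\<Sum>i\<in>A. smult (c i) (Stirling_op d a (f i)))"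
  by (induction A rule: infinite_finite_induct)
    (simp_all add: Stirling_op_def Euler_op_def pderiv_add pderiv_smult smult_add_right
      algebra_simps)

lemma Stirling_op_monom_pderiv:
  "Stirling_op d a (monom 1 m * (pderiv ^^ m) p) =
     smult (of_nat a + of_nat d * of_nat m) (monom 1 m * (pderiv ^^ m) p)
     + smult (of_nat d) (monom 1 (Suc m) * (pderiv ^^ Suc m) p)"
proof -
  have "monom 1 1 * pderiv (monom 1 m) = (smult (of_nat m) (monom 1 m) :: rat poly)"
    by (cases m) (simp_all add: pderiv_monom mult_monom smult_monom)
  then have "monom 1 1 * (pderiv (monom 1 m) * (pderiv ^^ m) p)
      = smult (of_nat m) (monom 1 m * (pderiv ^^ m) p)"
    by (metis mult.assoc mult_smult_left)
  moreover have "monom 1 1 * (monom 1 m * q) = monom 1 (Suc m) * q" for q :: "rat poly"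
    by (simp add: mult.assoc [symmetric] mult_monom)
  ultimately have "Euler_op (monom 1 m * (pderiv ^^ m) p) =
      smult (of_nat m) (monom 1 m * (pderiv ^^ m) p) + monom 1 (Suc m) * (pderiv ^^ Suc m) p"
    by (simp add: Euler_op_def pderiv_mult distrib_left mult.commute [of _ "pderiv (monom 1 m)"])
  then show ?thesis
    by (simp add: Stirling_op_def smult_add_right smult_add_left)
qed

lemma Stirling_op_power_eq:
  "(Stirling_op d a ^^ n) p =
     (\<Sum>m\<le>n. smult (S2_rec d a n m) (monom 1 m * (pderiv ^^ m) p))"
proof (induction n)
  case 0
  show ?case by simp
next
  case (Suc n)
  define g where "g m = monom 1 m * (pderiv ^^ m) p" for m
  \<comment> \<open>Scalars become constant polynomials, so that the sum is one of products in a
    single ring.\<close>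
  have "(\<Sum>m\<le>Suc n. [:S2_rec d a (Suc n) m:] * g m) =
      (\<Sum>m\<le>n. [:S2_rec d a n m:] *
        ([:of_nat a + of_nat d * of_nat m:] * g m + [:of_nat d:] * g (Suc m)))"
    by (rule sum_row_recurrence) (simp_all add: S2_rec_eq_0)
  moreover have "Stirling_op d a (g m) =
      smult (of_nat a + of_nat d * of_nat m) (g m) + smult (of_nat d) (g (Suc m))" for m
    unfolding g_def by (rule Stirling_op_monom_pderiv)
  ultimately show ?case
    by (simp add: Suc Stirling_op_sum_smult flip: g_def del: sum.atMost_Suc)
qed

text \<open>Testing on x^k gives a triangular system: x^m D^m multiplies x^k by k(k-1)...(k-m+1),
  which is 0 for m > k and k! for m = k. Hence the k-th coefficient is determined by the earlier
  ones.\<close>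

lemma normal_ordering_unique:
  fixes s t :: "nat \<Rightarrow> rat"
  assumes "\<And>p. (\<Sum>m\<le>n. smult (s m) (monom 1 m * (pderiv ^^ m) p)) =
      (\<Sum>m\<le>n. smult (t m) (monom 1 m * (pderiv ^^ m) p))"
  shows "k \<le> n \<Longrightarrow> s k = t k"
proof (induction k rule: less_induct)
  case (less k)
  define f :: "nat \<Rightarrow> rat" where "f m = coeff (monom 1 m * (pderiv ^^ m) (monom 1 k)) k" for m
  have f0: "f m = 0" if "k < m" for m
    using that by (simp add: f_def coeff_monom_mult)
  have fk: "f k \<noteq> 0"
    by (simp add: f_def coeff_monom_mult coeff_higher_pderiv pochhammer_eq_0_iff)
  have "(\<Sum>m\<le>n. s m * f m) = (\<Sum>m\<le>n. t m * f m)"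
    using arg_cong [OF assms [of "monom 1 k"], of "\<lambda>q. coeff q k"]
    by (simp add: coeff_sum f_def)
  moreover have "(\<Sum>m\<le>n. c m * f m) = c k * f k + (\<Sum>m<k. c m * f m)" for c
  proof -
    have "(\<Sum>m\<le>n. c m * f m) = (\<Sum>m\<le>k. c m * f m)"
      using less.prems f0 by (intro sum.mono_neutral_right) auto
    then show ?thesis
      by (simp add: lessThan_Suc_atMost [symmetric])
  qed
  ultimately have "s k * f k = t k * f k"
    using less by simp
  with fk show ?case by simp
qed

lemma S2_eq_S2_rec: "S2 d a = S2_rec d a"
  unfolding S2_def
proof (rule the_equality)
  show "(\<forall>n. (Stirling_op d a ^^ n) =
       (\<lambda>p. \<Sum>m\<le>n. smult (S2_rec d a n m) (monom 1 m * (pderiv ^^ m) p))) \<and>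
     (\<forall>n m. n < m \<longrightarrow> S2_rec d a n m = 0)"
    by (auto simp: Stirling_op_power_eq S2_rec_eq_0)
next
  fix S
  assume S: "(\<forall>n. (Stirling_op d a ^^ n) =
       (\<lambda>p. \<Sum>m\<le>n. smult (S n m) (monom 1 m * (pderiv ^^ m) p))) \<and>
     (\<forall>n m. n < m \<longrightarrow> S n m = 0)"
  have "S n m = S2_rec d a n m" for n m
  proof (cases "m \<le> n")
    case True
    show ?thesis
    proof (rule normal_ordering_unique [OF _ True])
      show "(\<Sum>m\<le>n. smult (S n m) (monom 1 m * (pderiv ^^ m) p)) =
          (\<Sum>m\<le>n. smult (S2_rec d a n m) (monom 1 m * (pderiv ^^ m) p))" for p
        using S by (metis Stirling_op_power_eq)
    qed
  next
    \<comment> \<open>Above the diagonal the operator identity says nothing; the convention fixes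
      the entries.\<close>
    case False
    then show ?thesis using S by (simp add: S2_rec_eq_0)
  qed
  then show "S = S2_rec d a" by blast
qed

section \<open>Lower triangular infinite matrices\<close>

lemma lt_mult_assoc:
  assumes "lower_triangular B"
  shows "lt_mult (lt_mult A B) C = lt_mult A (lt_mult B C)"
proof (intro ext)
  fix n m
  \<comment> \<open>The two bracketings truncate the sum over j at n and at k respectively; they
    agree because \<open>B k j\<close> = 0 for j > k.\<close>
  have row: "(\<Sum>j\<le>n. B k j * C j m) = (\<Sum>j\<le>k. B k j * C j m)" if "k \<le> n" for k
    using that assms by (intro sum.mono_neutral_right) (auto simp: lower_triangular_def)
  have "lt_mult (lt_mult A B) C n m = (\<Sum>j\<le>n. \<Sum>k\<le>n. A n k * B k j * C j m)"
    by (simp add: lt_mult_def sum_distrib_right)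
  also have "\<dots> = (\<Sum>k\<le>n. A n k * (\<Sum>j\<le>n. B k j * C j m))"
    by (subst sum.swap) (simp add: sum_distrib_left mult.assoc)
  also have "\<dots> = lt_mult A (lt_mult B C) n m"
    by (simp add: lt_mult_def row)
  finally show "lt_mult (lt_mult A B) C n m = lt_mult A (lt_mult B C) n m" .
qed

lemma lt_mult_id_left: "lt_mult id_matrix A = A"
  by (simp add: lt_mult_def id_matrix_def fun_eq_iff if_distrib [of "\<lambda>x. x * _"] cong: if_cong)

lemma lt_mult_id_right: "lower_triangular A \<Longrightarrow> lt_mult A id_matrix = A"
  by (auto simp: lt_mult_def id_matrix_def fun_eq_iff lower_triangular_def
      if_distrib [of "\<lambda>x. _ * x"] cong: if_cong)

text \<open>Uniqueness is the usual C = C(AB) = (CA)B = B.\<close>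

lemma lt_inverse_eqI:
  assumes "lower_triangular A" "lower_triangular B"
    and "lt_mult A B = id_matrix" "lt_mult B A = id_matrix"
  shows "lt_inverse A = B"
  unfolding lt_inverse_def
proof (rule the_equality)
  fix C
  assume "lower_triangular C \<and> lt_mult A C = id_matrix \<and> lt_mult C A = id_matrix"
  then show "C = B"
    by (metis assms lt_mult_assoc lt_mult_id_left lt_mult_id_right)
qed (use assms in blast)

section \<open>The two products with the candidate inverse\<close>

lemma S2_rec_mult_S1_rec:
  assumes "d \<ge> 1"
  shows "lt_mult (S2_rec d a) (S1_rec d a) = id_matrix"
proof -
  have "lt_mult (S2_rec d a) (S1_rec d a) n m = id_matrix n m" for n m
  proof (induction n arbitrary: m)
    case 0
    show ?case by (simp add: lt_mult_def id_matrix_def)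
  next
    case (Suc n)
    have "lt_mult (S2_rec d a) (S1_rec d a) (Suc n) m =
        (\<Sum>k\<le>n. S2_rec d a n k *
          ((of_nat a + of_nat d * of_nat k) * S1_rec d a k m + of_nat d * S1_rec d a (Suc k) m))"
      unfolding lt_mult_def by (rule sum_row_recurrence) (simp_all add: S2_rec_eq_0)
    \<comment> \<open>Multiplied by \<open>d\<close>, the recurrence of \<open>S1_rec\<close>
      cancels the weight a + d k and leaves column m - 1.\<close>
    also have "\<dots> = (\<Sum>k\<le>n. S2_rec d a n k * (if m = 0 then 0 else S1_rec d a k (m - 1)))"
      using assms by (cases m) (simp_all add: field_simps)
    also have "\<dots> = (if m = 0 then 0 else lt_mult (S2_rec d a) (S1_rec d a) n (m - 1))"
      by (simp add: lt_mult_def)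
    also have "\<dots> = id_matrix (Suc n) m"
      by (cases m) (simp_all add: Suc id_matrix_def)
    finally show ?case .
  qed
  then show ?thesis by blast
qed

lemma S1_rec_mult_S2_rec:
  assumes "d \<ge> 1"
  shows "lt_mult (S1_rec d a) (S2_rec d a) = id_matrix"
proof -
  have "lt_mult (S1_rec d a) (S2_rec d a) n m = id_matrix n m" for n m
  proof (induction n arbitrary: m)
    case 0
    show ?case by (simp add: lt_mult_def id_matrix_def)
  next
    case (Suc n)
    have "lt_mult (S1_rec d a) (S2_rec d a) (Suc n) m =
        (\<Sum>k\<le>n. S1_rec d a n k *
          (- (of_nat n + of_nat a / of_nat d) * S2_rec d a k m
            + inverse (of_nat d) * S2_rec d a (Suc k) m))"
      unfolding lt_mult_def by (rule sum_row_recurrence) (simp_all add: S1_rec_eq_0)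
    \<comment> \<open>Dividing the recurrence of \<open>S2_rec\<close> by \<open>d\<close> gives the
      weight a/d + m, so a/d cancels and m - n remains.\<close>
    also have "\<dots> = (\<Sum>k\<le>n. (of_nat m - of_nat n) * (S1_rec d a n k * S2_rec d a k m)
        + (if m = 0 then 0 else S1_rec d a n k * S2_rec d a k (m - 1)))"
      using assms by (intro sum.cong refl, cases m) (simp_all add: field_simps)
    also have "\<dots> = (of_nat m - of_nat n) * lt_mult (S1_rec d a) (S2_rec d a) n m
        + (if m = 0 then 0 else lt_mult (S1_rec d a) (S2_rec d a) n (m - 1))"
      by (simp add: lt_mult_def sum.distrib sum_distrib_left)
    \<comment> \<open>The factor m - n kills the only nonzero entry of row n of the
      identity.\<close>
    also have "\<dots> = id_matrix (Suc n) m"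
      by (cases m) (auto simp: Suc id_matrix_def)
    finally show ?case .
  qed
  then show ?thesis by blast
qed

lemma S1_eq_S1_rec:
  assumes "d \<ge> 1"
  shows "S1 d a = S1_rec d a"
  unfolding S1_def S2_eq_S2_rec
  using assms
  by (intro lt_inverse_eqI S2_rec_mult_S1_rec S1_rec_mult_S2_rec)
    (simp_all add: lower_triangular_def S2_rec_eq_0 S1_rec_eq_0)

theorem mainTheorem16:
  fixes d a :: nat
  assumes "d \<ge> 1"
  shows "S1p_hat d a 0 0 = 1 \<and>
    (\<forall>n::nat. \<forall>m::int. 1 \<le> n \<longrightarrow> 0 \<le> m \<longrightarrow> m \<le> int n \<longrightarrow>
      S1p_hat d a n m =
        S1p_hat d a (n - 1) (m - 1) +
        (of_nat d * of_nat n - (of_nat d - of_nat a)) * S1p_hat d a (n - 1) m)"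
proof (intro conjI allI impI)
  show "S1p_hat d a 0 0 = 1"
    using assms by (simp add: S1p_hat_def S1_eq_S1_rec)
next
  fix n :: nat and m :: int
  assume "1 \<le> n" "0 \<le> m" "m \<le> int n"
  then obtain n' k where n: "n = Suc n'" and m: "m = int k"
    by (metis Suc_le_D One_nat_def nonneg_int_cases)
  \<comment> \<open>The exponents i + j and i - j have the same parity for j \<le> i; for j > i both
    sides are 0.\<close>
  have hat: "S1p_hat d a i (int j) = of_nat d ^ i * (- 1) ^ (i + j) * S1_rec d a i j" for i j
    by (simp add: S1p_hat_def S1_eq_S1_rec [OF assms] S1_rec_eq_0 minus_one_power_iff)
  have hat_neg: "S1p_hat d a i (- 1) = 0" for i
    by (simp add: S1p_hat_def)
  show "S1p_hat d a n m = S1p_hat d a (n - 1) (m - 1) +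
        (of_nat d * of_nat n - (of_nat d - of_nat a)) * S1p_hat d a (n - 1) m"
  \<comment> \<open>As n = n' + 1, the factor is d n' + a. The power of d absorbs the division by
    \<open>d\<close>, and the sign turns -(n' + a/d) positive. For k = 0 the left neighbour is the
    zero column -1.\<close>
  proof (cases k)
    case 0
    then show ?thesis
      using assms hat [of _ 0] by (simp add: n m hat_neg field_simps)
  next
    case (Suc j)
    then have "m - 1 = int j" by (simp add: m)
    then show ?thesis
      using assms by (simp add: n m Suc hat field_simps del: of_nat_Suc) (simp add: hat algebra_simps)
  qed
qed

end
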